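(* Let $\ddot{\mathbb A}$ be any BiKAT over a KAT $\mathbb A$. For actions $c,c'\in\mathbb A$ and bitests $P,Q$ write $c\mid c':P\approx> Q$ for the equation $P;\langle c\mid c'\rangle;\neg Q=0$. Then for all actions $c,c',d,d'\in\mathbb A$, tests $e,e'\in\mathbb B$ and bitests $P,Q,R,S\in\ddot{\mathbb B}$: (dSeq) if $c\mid c':P\approx>R$ and $d\mid d':R\approx>Q$ then $c;d\mid c';d':P\approx>Q$; (dIf) if $P\le \langle e\mid e'\rangle+\langle\neg e\mid\neg e'\rangle$, $c\mid c':P;\langle e\mid e'\rangle\approx>Q$ and $d\mid d':P;\langle\neg e\mid\neg e'\rangle\approx>Q$, then $(e;c+\neg e;d)\mid(e';c'+\neg e';d'):P\approx>Q$; (dWh) if $P\le \langle e\mid e'\rangle+\langle\neg e\mid\neg e'\rangle$ and $c\mid c':P;\langle e\mid e'\rangle\approx>P$, then $(e;c)^*;\neg e\mid (e';c')^*;\neg e':P\approx>P;\langle\neg e\mid\neg e'\rangle$; (rDisj) if $c\mid d:P\approx>Q$ and $c\mid d:R\approx>Q$ then $c\mid d:P+R\approx>Q$; (SeqSk) if $c\mid 1:P\approx>R$ and $d\mid 1:R\approx>Q$ then $c;d\mid 1:P\approx>Q$; (rConseq) if $R\le P$, $c\mid d:P\approx>Q$ and $Q\le S$ then $c\mid d:R\approx>S$.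
   Context: A KAT $(\mathbb A,\mathbb B,+,;,{}^*,\neg,1,0)$ is a Kleene algebra with a Boolean subalgebra $\mathbb B\subseteq\mathbb A$ of tests; $a\le b$ iff $a+b=b$. A BiKAT over $\mathbb A$ is a KAT $(\ddot{\mathbb A},\ddot{\mathbb B},\dots)$ with KAT homomorphisms $\langle\cdot\,],[\,\cdot\rangle:\mathbb A\to\ddot{\mathbb A}$ (preserving $0,1,+,;,{}^*$, mapping tests to tests, preserving test negation) satisfying $\langle x];[y\rangle=[y\rangle;\langle x]$ for all $x,y\in\mathbb A$; elements of $\ddot{\mathbb B}$ are bitests, and $\langle a\mid b\rangle:=\langle a];[b\rangle$. In program notation, $\mathsf{skip}=1$, $\mathsf{if}\ e\ \mathsf{then}\ c\ \mathsf{else}\ d = e;c+\neg e;d$, $\mathsf{while}\ e\ \mathsf{do}\ c=(e;c)^*;\neg e$; conjunction of bitests is $;$, disjunction is $+$, implication is $\le$. *)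

theory Defs
  imports Main
begin

text \<open>
  Sequential composition is written \<open>*\<close>. The library class \<open>semiring_1\<close> is avoided because it
  includes \<open>0 \<noteq> 1\<close>, which would rule out the degenerate algebra.
\<close>

class kleene_algebra = semiring_0 + monoid_mult + ord +
  fixes star :: "'a \<Rightarrow> 'a"  ("_\<^sup>\<star>" [1000] 999)
  assumes add_idem: "x + x = x"
    and less_eq_iff_add: "x \<le> y \<longleftrightarrow> x + y = y"
    and less_iff: "x < y \<longleftrightarrow> x \<le> y \<and> x \<noteq> y"
    and star_unfoldl: "1 + x * x\<^sup>\<star> \<le> x\<^sup>\<star>"
    and star_unfoldr: "1 + x\<^sup>\<star> * x \<le> x\<^sup>\<star>"
    and star_inductl: "y + x * z \<le> z \<Longrightarrow> x\<^sup>\<star> * y \<le> z"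
    and star_inductr: "y + z * x \<le> z \<Longrightarrow> y * x\<^sup>\<star> \<le> z"
begin

subclass order
proof
  fix x y z :: 'a
  show "x < y \<longleftrightarrow> x \<le> y \<and> \<not> y \<le> x"
    by (metis add.commute less_eq_iff_add less_iff)
  show "x \<le> x"
    by (simp add: less_eq_iff_add add_idem)
  show "x \<le> z" if "x \<le> y" "y \<le> z"
    using that by (metis add.assoc less_eq_iff_add)
  show "x = y" if "x \<le> y" "y \<le> x"
    using that by (metis add.commute less_eq_iff_add)
qed

end

text \<open>
  The tests form a Boolean algebra under \<open>+\<close>, \<open>*\<close>, \<open>neg\<close>, \<open>0\<close>, \<open>1\<close>. The axioms below are those of
  Huntington's axioms that do not already hold in every Kleene algebra. The values of \<open>neg\<close> outside
  the set of tests are irrelevant.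
\<close>

locale kat =
  fixes tests :: "'a::kleene_algebra set"
    and neg :: "'a \<Rightarrow> 'a"
  assumes zero_test: "0 \<in> tests"
    and one_test: "1 \<in> tests"
    and add_test: "p \<in> tests \<Longrightarrow> q \<in> tests \<Longrightarrow> p + q \<in> tests"
    and mult_test: "p \<in> tests \<Longrightarrow> q \<in> tests \<Longrightarrow> p * q \<in> tests"
    and neg_test: "p \<in> tests \<Longrightarrow> neg p \<in> tests"
    and test_mult_commute: "p \<in> tests \<Longrightarrow> q \<in> tests \<Longrightarrow> p * q = q * p"
    and test_add_mult_distrib:
      "p \<in> tests \<Longrightarrow> q \<in> tests \<Longrightarrow> r \<in> tests \<Longrightarrow> p + q * r = (p + q) * (p + r)"
    and test_add_neg: "p \<in> tests \<Longrightarrow> p + neg p = 1"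
    and test_mult_neg: "p \<in> tests \<Longrightarrow> p * neg p = 0"

locale kat_hom = source: kat tests neg + target: kat tests' neg'
  for tests :: "'a::kleene_algebra set" and neg :: "'a \<Rightarrow> 'a"
    and tests' :: "'b::kleene_algebra set" and neg' :: "'b \<Rightarrow> 'b" +
  fixes h :: "'a \<Rightarrow> 'b"
  assumes hom_zero: "h 0 = 0"
    and hom_one: "h 1 = 1"
    and hom_add: "h (x + y) = h x + h y"
    and hom_mult: "h (x * y) = h x * h y"
    and hom_star: "h (x\<^sup>\<star>) = (h x)\<^sup>\<star>"
    and hom_test: "p \<in> tests \<Longrightarrow> h p \<in> tests'"
    and hom_neg: "p \<in> tests \<Longrightarrow> h (neg p) = neg' (h p)"

text \<open>\<open>lft\<close> is the embedding \<open>\<langle>\<cdot>]\<close> and \<open>rgt\<close> is the embedding \<open>[\<cdot>\<rangle>\<close>.\<close>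

locale bikat =
  left: kat_hom tests neg bitests bineg lft + right: kat_hom tests neg bitests bineg rgt
  for tests :: "'a::kleene_algebra set" and neg :: "'a \<Rightarrow> 'a"
    and bitests :: "'b::kleene_algebra set" and bineg :: "'b \<Rightarrow> 'b"
    and lft :: "'a \<Rightarrow> 'b" and rgt :: "'a \<Rightarrow> 'b" +
  assumes lr_commute: "lft x * rgt y = rgt y * lft x"

definition bipair :: "('a \<Rightarrow> 'b) \<Rightarrow> ('a \<Rightarrow> 'b) \<Rightarrow> 'a \<Rightarrow> 'a \<Rightarrow> 'b::kleene_algebra" where
  "bipair lft rgt a b = lft a * rgt b"

text \<open>The judgement \<open>c | c' : P \<approx>> Q\<close>.\<close>

definition rel_spec ::
  "('b \<Rightarrow> 'b) \<Rightarrow> ('a \<Rightarrow> 'b) \<Rightarrow> ('a \<Rightarrow> 'b) \<Rightarrow> 'a \<Rightarrow> 'a \<Rightarrow> 'b \<Rightarrow> 'b::kleene_algebra \<Rightarrow> bool" where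
  "rel_spec bineg lft rgt c c' P Q \<longleftrightarrow> P * bipair lft rgt c c' * bineg Q = 0"

end

theory Submission
  imports Defs
begin

text \<open>
  For bitests, \<open>P * x * neg Q = 0\<close> means \<open>P * x \<le> x * Q\<close>, so judgements compose and all rules but the
  one for loops follow by distributing pairs over \<open>+\<close> and \<open>*\<close>. For loops, write \<open>x = \<langle>e;c]\<close> and
  \<open>y = [e';c'\<rangle>\<close>. Since \<open>x\<close> and \<open>y\<close> commute, \<open>x\<^sup>\<star> * y\<^sup>\<star> \<le> (x * y)\<^sup>\<star> * (x\<^sup>\<star> + y\<^sup>\<star>)\<close>: run both loops in
  lockstep, then finish one of them alone. The lockstep part preserves the invariant \<open>P\<close>, and as
  \<open>P\<close> forces the guards to agree, the part running alone cannot take a step.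
\<close>

section \<open>Order and star laws of Kleene algebras\<close>

context kleene_algebra
begin

lemma le_0_iff_eq_0: "x \<le> 0 \<longleftrightarrow> x = 0"
  by (simp add: less_eq_iff_add)

lemma add_le_iff: "x + y \<le> z \<longleftrightarrow> x \<le> z \<and> y \<le> z"
  by (metis less_eq_iff_add add.assoc add.commute add_idem)

lemma le_add_left: "x \<le> x + y"
  using add_le_iff by blast

lemma le_add_right: "y \<le> x + y"
  using add_le_iff by blast

lemma mult_left_monotone: "x \<le> y \<Longrightarrow> z * x \<le> z * y"
  by (metis less_eq_iff_add distrib_left)

lemma mult_right_monotone: "x \<le> y \<Longrightarrow> x * z \<le> y * z"
  by (metis less_eq_iff_add distrib_right)

lemma one_le_star: "1 \<le> x\<^sup>\<star>"
  using star_unfoldl add_le_iff by blast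

lemma mult_star_le: "x * x\<^sup>\<star> \<le> x\<^sup>\<star>"
  using star_unfoldl add_le_iff by blast

lemma star_mult_le: "x\<^sup>\<star> * x \<le> x\<^sup>\<star>"
  using star_unfoldr add_le_iff by blast

text \<open>The right-hand side contains \<open>1\<close> and is closed under multiplication by
  \<open>x\<close> on the left, so star induction applies.\<close>

lemma star_le_unfoldl: "x\<^sup>\<star> \<le> 1 + x * x\<^sup>\<star>"
proof -
  have "1 + x * (1 + x * x\<^sup>\<star>) \<le> 1 + x * x\<^sup>\<star>"
    using mult_left_monotone[OF star_unfoldl, of x x] le_add_left le_add_right
    by (metis add_le_iff order.trans)
  from star_inductl[OF this] show ?thesis by simp
qed

text \<open>Pushing \<open>a\<close> over one \<open>x\<close> leaves a \<open>y\<close> on its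
  left, which \<open>y\<^sup>\<star>\<close> absorbs. With a test as \<open>a\<close> and
  \<open>x = y\<close>, this says that an invariant of one iteration is an invariant of the
  loop.\<close>

lemma star_simulation_left:
  assumes "a * x \<le> y * a"
  shows "a * x\<^sup>\<star> \<le> y\<^sup>\<star> * a"
proof (rule star_inductr)
  have "y\<^sup>\<star> * a * x \<le> y\<^sup>\<star> * y * a"
    using mult_left_monotone[OF assms] by (simp add: mult.assoc)
  also have "\<dots> \<le> y\<^sup>\<star> * a"
    by (rule mult_right_monotone[OF star_mult_le])
  finally show "a + y\<^sup>\<star> * a * x \<le> y\<^sup>\<star> * a"
    using mult_right_monotone[OF one_le_star, of a y] by (simp add: add_le_iff)
qed

lemma star_simulation_right:
  assumes "x * a \<le> a * y"
  shows "x\<^sup>\<star> * a \<le> a * y\<^sup>\<star>"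
proof (rule star_inductl)
  have "x * (a * y\<^sup>\<star>) \<le> a * (y * y\<^sup>\<star>)"
    using mult_right_monotone[OF assms] by (simp add: mult.assoc)
  also have "\<dots> \<le> a * y\<^sup>\<star>"
    by (rule mult_left_monotone[OF mult_star_le])
  finally show "a + x * (a * y\<^sup>\<star>) \<le> a * y\<^sup>\<star>"
    using mult_left_monotone[OF one_le_star, of a y] by (simp add: add_le_iff)
qed

lemma star_commute:
  assumes "a * x = x * a"
  shows "a * x\<^sup>\<star> = x\<^sup>\<star> * a"
  by (rule order.antisym) (simp_all add: star_simulation_left star_simulation_right assms)

text \<open>By star induction, the bound must contain \<open>y\<^sup>\<star>\<close> and absorb a
  further \<open>x\<close> on the left. Such an \<open>x\<close> moves past the lockstep rounds and
  either joins \<open>x\<^sup>\<star>\<close> or meets \<open>y\<^sup>\<star>\<close>.\<close>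

lemma star_lockstep:
  assumes "x * y = y * x"
  shows "x\<^sup>\<star> * y\<^sup>\<star> \<le> (x * y)\<^sup>\<star> * (x\<^sup>\<star> + y\<^sup>\<star>)"
proof (rule star_inductl)
  let ?w = "(x * y)\<^sup>\<star>"
  let ?z = "?w * (x\<^sup>\<star> + y\<^sup>\<star>)"
  have w: "x * ?w = ?w * x"
    by (rule star_commute) (metis assms mult.assoc)
  have zx: "?w * x\<^sup>\<star> \<le> ?z" and zy: "?w * y\<^sup>\<star> \<le> ?z"
    by (simp_all add: mult_left_monotone le_add_left le_add_right)
  have "y\<^sup>\<star> \<le> ?w * y\<^sup>\<star>"
    using mult_right_monotone[OF one_le_star, of "y\<^sup>\<star>"] by simp
  then have y: "y\<^sup>\<star> \<le> ?z"
    using zy by (rule order.trans)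
  have "x * (?w * x\<^sup>\<star>) = ?w * (x * x\<^sup>\<star>)"
    using w by (metis mult.assoc)
  also have "\<dots> \<le> ?w * x\<^sup>\<star>"
    by (rule mult_left_monotone[OF mult_star_le])
  finally have xx: "x * (?w * x\<^sup>\<star>) \<le> ?z"
    using zx by (rule order.trans)
  have "x \<le> x\<^sup>\<star>"
    using mult_left_monotone[OF one_le_star, of x x] mult_star_le[of x] by simp
  then have x: "?w * x \<le> ?z"
    using zx mult_left_monotone order.trans by blast
  have "?w * (x * y) * y\<^sup>\<star> \<le> ?w * y\<^sup>\<star>"
    by (rule mult_right_monotone[OF star_mult_le])
  then have xy: "?w * (x * y) * y\<^sup>\<star> \<le> ?z"
    using zy by (rule order.trans)
  have "x * (?w * y\<^sup>\<star>) = ?w * x * y\<^sup>\<star>"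
    using w by (metis mult.assoc)
  \<comment> \<open>When \<open>x\<close> meets \<open>y\<^sup>\<star>\<close>, either no
    \<open>y\<close> is left and \<open>x\<close> runs alone, or the first \<open>y\<close> pairs
    with it to form one more lockstep round.\<close>
  also have "\<dots> \<le> ?w * x * (1 + y * y\<^sup>\<star>)"
    by (rule mult_left_monotone[OF star_le_unfoldl])
  also have "\<dots> = ?w * x + ?w * (x * y) * y\<^sup>\<star>"
    by (simp add: distrib_left mult.assoc)
  also have "\<dots> \<le> ?z"
    using x xy by (simp add: add_le_iff)
  finally show "y\<^sup>\<star> + x * ?z \<le> ?z"
    using y xx by (simp add: add_le_iff distrib_left)
qed

lemma mult_star_collapse:
  assumes "a * x * x\<^sup>\<star> * b = 0"
  shows "a * x\<^sup>\<star> * b \<le> a * b"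
proof -
  have "a * x\<^sup>\<star> * b \<le> a * (1 + x * x\<^sup>\<star>) * b"
    by (intro mult_right_monotone mult_left_monotone star_le_unfoldl)
  also have "\<dots> = a * b"
    using assms by (simp add: distrib_left distrib_right mult.assoc)
  finally show ?thesis .
qed

end

section \<open>Hoare triples and agreement of tests\<close>

context kat
begin

lemma test_le_one: "p \<in> tests \<Longrightarrow> p \<le> 1"
  by (metis le_add_left test_add_neg)

lemma neg_mult_test: "p \<in> tests \<Longrightarrow> neg p * p = 0"
  by (metis neg_test test_mult_commute test_mult_neg)

text \<open>Forwards, split \<open>1\<close> as \<open>q + neg q\<close> after \<open>x\<close> and
  drop the leading \<open>p\<close>, which is below \<open>1\<close>. Backwards, multiply by
  \<open>neg q\<close> on the right.\<close>

lemma mult_neg_eq_0_iff: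
  assumes "p \<in> tests" "q \<in> tests"
  shows "p * x * neg q = 0 \<longleftrightarrow> p * x \<le> x * q"
proof
  assume "p * x * neg q = 0"
  then have "p * x = p * x * q"
    by (metis add_0_right assms(2) distrib_left mult_1_right test_add_neg)
  also have "\<dots> \<le> x * q"
    using mult_right_monotone[OF test_le_one[OF assms(1)], of "x * q"] by (simp add: mult.assoc)
  finally show "p * x \<le> x * q" .
next
  assume "p * x \<le> x * q"
  from mult_right_monotone[OF this, of "neg q"] show "p * x * neg q = 0"
    by (simp add: mult.assoc test_mult_neg assms le_0_iff_eq_0)
qed

text \<open>Tests commute, so each mixed product meets a complementary pair, in \<open>a\<close> or
  in \<open>b\<close>, in both summands of the bound on \<open>p\<close>.\<close>

lemma guards_agree:
  assumes "p \<in> tests" "a \<in> tests" "b \<in> tests" "p \<le> a * b + neg a * neg b"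
  shows "p * (a * neg b) = 0" "p * (neg a * b) = 0"
proof -
  have "neg a * neg b * (a * neg b) = 0" "a * b * (neg a * b) = 0"
    by (metis assms(2,3) mult.assoc mult_zero_left mult_zero_right neg_mult_test neg_test
        test_mult_commute test_mult_neg)+
  moreover have "a * b * (a * neg b) = 0" "neg a * neg b * (neg a * b) = 0"
    by (metis assms(2,3) mult.assoc mult_zero_right neg_mult_test neg_test
        test_mult_commute test_mult_neg)+
  ultimately show "p * (a * neg b) = 0" "p * (neg a * b) = 0"
    using mult_right_monotone[OF assms(4)] by (metis add_0_left distrib_right le_0_iff_eq_0)+
qed

end

section \<open>The relational proof rules\<close>

context bikat
begin

abbreviation pair :: "'a \<Rightarrow> 'a \<Rightarrow> 'b" where
  "pair \<equiv> bipair lft rgt"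

abbreviation spec :: "'a \<Rightarrow> 'a \<Rightarrow> 'b \<Rightarrow> 'b \<Rightarrow> bool" where
  "spec \<equiv> rel_spec bineg lft rgt"

text \<open>The only exchange needed is that of the inner factors \<open>lft b\<close> and
  \<open>rgt a'\<close>.\<close>

lemma pair_mult: "pair (a * b) (a' * b') = pair a a' * pair b b'"
  unfolding bipair_def left.hom_mult right.hom_mult by (metis lr_commute mult.assoc)

lemma pair_add:
  "pair (a + b) (a' + b') = pair a a' + pair a b' + (pair b a' + pair b b')"
  unfolding bipair_def left.hom_add right.hom_add by (simp add: distrib_left distrib_right add_ac)

lemma pair_test: "e \<in> tests \<Longrightarrow> e' \<in> tests \<Longrightarrow> pair e e' \<in> bitests"
  by (simp add: bipair_def left.hom_test right.hom_test left.target.mult_test)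

lemma spec_iff:
  "P \<in> bitests \<Longrightarrow> Q \<in> bitests \<Longrightarrow> spec c c' P Q \<longleftrightarrow> P * pair c c' \<le> pair c c' * Q"
  unfolding rel_spec_def by (rule left.target.mult_neg_eq_0_iff)

lemma spec_seq:
  assumes "P \<in> bitests" "Q \<in> bitests" "R \<in> bitests" "spec c c' P R" "spec d d' R Q"
  shows "spec (c * d) (c' * d') P Q"
proof -
  have "P * pair c c' * pair d d' \<le> pair c c' * R * pair d d'"
    using assms by (simp add: spec_iff mult_right_monotone)
  also have "\<dots> \<le> pair c c' * (pair d d' * Q)"
    using assms by (simp add: spec_iff mult_left_monotone mult.assoc)
  finally show ?thesis
    using assms by (simp add: spec_iff pair_mult mult.assoc)
qed

text \<open>The pair of conditionals expands into four products: agreement of the guards kills the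
  two mixed ones, and the premises kill the other two.\<close>

lemma spec_if:
  assumes "e \<in> tests" "e' \<in> tests" "P \<in> bitests"
    and "P \<le> pair e e' + pair (neg e) (neg e')"
    and "spec c c' (P * pair e e') Q" "spec d d' (P * pair (neg e) (neg e')) Q"
  shows "spec (e * c + neg e * d) (e' * c' + neg e' * d') P Q"
proof -
  have "P * pair e (neg e') = 0" "P * pair (neg e) e' = 0"
    using left.target.guards_agree[of P "lft e" "rgt e'"] assms
    by (simp_all add: bipair_def left.hom_test right.hom_test left.hom_neg right.hom_neg)
  \<comment> \<open>The arbitrary factor \<open>x\<close> matches the right-associated products of
    the expansion.\<close>
  then have "P * (pair e (neg e') * x) = 0" "P * (pair (neg e) e' * x) = 0" for x
    by (metis mult.assoc mult_zero_left)+
  then show ?thesis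
    using assms(5,6)
    by (simp add: rel_spec_def pair_add pair_mult distrib_left distrib_right mult.assoc)
qed

lemma spec_while:
  assumes e: "e \<in> tests" and e': "e' \<in> tests" and P: "P \<in> bitests"
    and agree: "P \<le> pair e e' + pair (neg e) (neg e')"
    and body: "spec c c' (P * pair e e') P"
  shows "spec ((e * c)\<^sup>\<star> * neg e) ((e' * c')\<^sup>\<star> * neg e') P (P * pair (neg e) (neg e'))"
proof -
  define x y n n' where "x = lft (e * c)" and "y = rgt (e' * c')"
    and "n = lft (neg e)" and "n' = rgt (neg e')"
  have nn: "pair (neg e) (neg e') = n * n'"
    by (simp add: bipair_def n_def n'_def)
  have exit_test: "P * (n * n') \<in> bitests"
    using pair_test[of "neg e" "neg e'"] e e' P
    by (simp add: nn left.source.neg_test left.target.mult_test)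
  have xy: "x * y = y * x" and xn': "n' * x = x * n'" and yn: "n * y = y * n"
    by (simp_all add: x_def y_def n_def n'_def lr_commute)
  have x_eq: "x = lft e * lft c" and y_eq: "y = rgt e' * rgt c'"
    by (simp_all add: x_def y_def left.hom_mult right.hom_mult)
  have "P * (lft e * n') = 0" "P * (n * rgt e') = 0"
    using left.target.guards_agree[of P "lft e" "rgt e'"] assms
    by (simp_all add: bipair_def left.hom_test right.hom_test left.hom_neg right.hom_neg
        n_def n'_def)
  \<comment> \<open>The exit test of one side commutes with the action of the other, so it can be
    moved next to \<open>P\<close> and the opposite guard, where it contradicts agreement.\<close>
  then have stuck: "P * x * n' = 0" "P * y * n = 0"
    unfolding x_eq y_eq n_def n'_def by (metis lr_commute mult.assoc mult_zero_left)+
  \<comment> \<open>Moving \<open>n'\<close> left across \<open>x\<^sup>\<star>\<close> exposes the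
    vanishing factor \<open>P * x * n'\<close>; hence only zero lone iterations survive.\<close>
  have "P * x * x\<^sup>\<star> * (n * n') = P * x * n' * x\<^sup>\<star> * n"
    using star_commute[OF xn'] lr_commute by (simp add: n_def n'_def mult.assoc)
  then have alone_x: "P * x\<^sup>\<star> * (n * n') \<le> P * (n * n')"
    by (intro mult_star_collapse) (simp add: stuck)
  have "P * y * y\<^sup>\<star> * (n * n') = P * y * n * y\<^sup>\<star> * n'"
    using star_commute[OF yn] by (metis mult.assoc)
  then have alone_y: "P * y\<^sup>\<star> * (n * n') \<le> P * (n * n')"
    by (intro mult_star_collapse) (simp add: stuck)
  have pxy: "x * y = pair e e' * pair c c'"
    unfolding pair_mult[symmetric] by (simp add: x_def y_def bipair_def)
  have "P * (x * y) * bineg P = 0"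
    using body by (simp add: pxy rel_spec_def mult.assoc)
  then have "P * (x * y)\<^sup>\<star> \<le> (x * y)\<^sup>\<star> * P"
    using P by (simp add: left.target.mult_neg_eq_0_iff star_simulation_left)
  then have inv: "P * (x * y)\<^sup>\<star> * z \<le> (x * y)\<^sup>\<star> * P * z" for z
    by (rule mult_right_monotone)
  \<comment> \<open>The left exit test \<open>n\<close> passes the right loop
    \<open>y\<^sup>\<star>\<close>, which collects both exit tests at the end.\<close>
  have "lft ((e * c)\<^sup>\<star> * neg e) * rgt ((e' * c')\<^sup>\<star> * neg e') = x\<^sup>\<star> * y\<^sup>\<star> * (n * n')"
    using star_commute[OF yn]
    by (simp add: left.hom_mult right.hom_mult left.hom_star right.hom_star
        x_def y_def n_def n'_def) (metis mult.assoc)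
  then have "P * pair ((e * c)\<^sup>\<star> * neg e) ((e' * c')\<^sup>\<star> * neg e')
      = P * (x\<^sup>\<star> * y\<^sup>\<star>) * (n * n')"
    by (simp add: bipair_def mult.assoc)
  also have "\<dots> \<le> P * ((x * y)\<^sup>\<star> * (x\<^sup>\<star> + y\<^sup>\<star>)) * (n * n')"
    by (intro mult_right_monotone mult_left_monotone star_lockstep xy)
  also have "\<dots> \<le> (x * y)\<^sup>\<star> * (P * x\<^sup>\<star> * (n * n') + P * y\<^sup>\<star> * (n * n'))"
    using inv[of "(x\<^sup>\<star> + y\<^sup>\<star>) * (n * n')"] by (simp add: mult.assoc distrib_left distrib_right)
  also have "\<dots> \<le> (x * y)\<^sup>\<star> * (P * (n * n'))"
    using alone_x alone_y by (intro mult_left_monotone) (simp add: add_le_iff)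
  \<comment> \<open>The bound ends in the postcondition itself, so its negation annihilates
    it.\<close>
  finally have "P * pair ((e * c)\<^sup>\<star> * neg e) ((e' * c')\<^sup>\<star> * neg e') * bineg (P * (n * n'))
      \<le> (x * y)\<^sup>\<star> * (P * (n * n')) * bineg (P * (n * n'))"
    by (rule mult_right_monotone)
  also have "\<dots> = 0"
    using left.target.test_mult_neg[OF exit_test] by (simp add: mult.assoc)
  finally show ?thesis
    by (simp add: rel_spec_def nn le_0_iff_eq_0)
qed

lemma spec_disj: "spec c d P Q \<Longrightarrow> spec c d R Q \<Longrightarrow> spec c d (P + R) Q"
  by (simp add: rel_spec_def distrib_right)

lemma spec_conseq:
  assumes "P \<in> bitests" "Q \<in> bitests" "R \<in> bitests" "S \<in> bitests"
    and "R \<le> P" "spec c d P Q" "Q \<le> S"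
  shows "spec c d R S"
proof -
  have "R * pair c d \<le> P * pair c d"
    using assms by (simp add: mult_right_monotone)
  also have "\<dots> \<le> pair c d * Q"
    using assms by (simp add: spec_iff)
  also have "\<dots> \<le> pair c d * S"
    using assms by (simp add: mult_left_monotone)
  finally show ?thesis
    using assms by (simp add: spec_iff)
qed

end

theorem theorem6p1:
  fixes tests :: "'a::kleene_algebra set" and neg :: "'a \<Rightarrow> 'a"
    and bitests :: "'b::kleene_algebra set" and bineg :: "'b \<Rightarrow> 'b"
    and lft rgt :: "'a \<Rightarrow> 'b"
    and c c' d d' e e' :: 'a
    and P Q R S :: 'b
  assumes "bikat tests neg bitests bineg lft rgt"
    and "e \<in> tests" and "e' \<in> tests"
    and "P \<in> bitests" and "Q \<in> bitests" and "R \<in> bitests" and "S \<in> bitests"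
  shows
    "(rel_spec bineg lft rgt c c' P R \<and>
      rel_spec bineg lft rgt d d' R Q
      \<longrightarrow> rel_spec bineg lft rgt (c * d) (c' * d') P Q) \<and>
     (P \<le> bipair lft rgt e e' + bipair lft rgt (neg e) (neg e') \<and>
      rel_spec bineg lft rgt c c' (P * bipair lft rgt e e') Q \<and>
      rel_spec bineg lft rgt d d' (P * bipair lft rgt (neg e) (neg e')) Q
      \<longrightarrow> rel_spec bineg lft rgt (e * c + neg e * d) (e' * c' + neg e' * d') P Q) \<and>
     (P \<le> bipair lft rgt e e' + bipair lft rgt (neg e) (neg e') \<and>
      rel_spec bineg lft rgt c c' (P * bipair lft rgt e e') P
      \<longrightarrow> rel_spec bineg lft rgt ((e * c)\<^sup>\<star> * neg e) ((e' * c')\<^sup>\<star> * neg e') P (P * bipair lft rgt (neg e) (neg e'))) \<and>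
     (rel_spec bineg lft rgt c d P Q \<and>
      rel_spec bineg lft rgt c d R Q
      \<longrightarrow> rel_spec bineg lft rgt c d (P + R) Q) \<and>
     (rel_spec bineg lft rgt c 1 P R \<and>
      rel_spec bineg lft rgt d 1 R Q
      \<longrightarrow> rel_spec bineg lft rgt (c * d) 1 P Q) \<and>
     (R \<le> P \<and>
      rel_spec bineg lft rgt c d P Q \<and>
      Q \<le> S
      \<longrightarrow> rel_spec bineg lft rgt c d R S)"
proof -
  interpret bikat tests neg bitests bineg lft rgt
    by (rule assms(1))
  \<comment> \<open>SeqSk is the instance of \<open>spec_seq\<close> with \<open>1\<close> for both
    right-hand actions, as \<open>1 * 1 = 1\<close>.\<close>
  show ?thesis
    using assms(2-) spec_seq[of P Q R c c' d d'] spec_seq[of P Q R c 1 d 1]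
      spec_if[of e e' P c c' Q d d'] spec_while[of e e' P c c'] spec_disj[of c d P Q R]
      spec_conseq[of P Q R S c d]
    by auto
qed

end
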